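(* Let $k$ be a time index and consider the estimation error time update $$\delta\mathbf{x}_{k+1}=\mathbf{A}_k\,\delta\mathbf{x}_k+\mathbf{B}_p\,\mathbf{p}_k+\mathbf{B}_w\,\mathbf{w}_k,\qquad \mathbf{p}_k=\mathbf{\Delta}_k(\boldsymbol{\theta}_k),\qquad \boldsymbol{\theta}_k=\mathbf{C}_\theta\,\delta\mathbf{x}_k,$$ where $\delta\mathbf{x}_k,\delta\mathbf{x}_{k+1}$ are random vectors in $\mathbb{R}^{n}$, $\mathbf{p}_k$ is a random vector in $\mathbb{R}^{n_p}$, $\mathbf{A}_k\in\mathbb{R}^{n\times n}$, $\mathbf{B}_p\in\mathbb{R}^{n\times n_p}$, $\mathbf{B}_w\in\mathbb{R}^{n\times n_w}$, $\mathbf{C}_\theta\in\mathbb{R}^{n_\theta\times n}$ are known (non-random) matrices, and $\mathbf{\Delta}_k$ is a static (memoryless) nonlinear function with values in $\mathbb{R}^{n_p}$. The process noise $\mathbf{w}_k\in\mathbb{R}^{n_w}$ is zero-mean Gaussian white noise with $\mathbb{E}(\mathbf{w}_k\mathbf{w}_k^{\mathsf T})=\mathbf{Q}$, uncorrelated with $\delta\mathbf{x}_k$ and $\mathbf{p}_k$, i.e. $\mathbb{E}(\mathbf{w}_k\,\delta\mathbf{x}_k^{\mathsf T})=\mathbf{0}$ and $\mathbb{E}(\mathbf{w}_k\mathbf{p}_k^{\mathsf T})=\mathbf{0}$. Let $\mathbf{P}_k^+=\mathbb{E}(\delta\mathbf{x}_k\,\delta\mathbf{x}_k^{\mathsf T})$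 and $\mathbf{P}_{k+1}^-=\mathbb{E}(\delta\mathbf{x}_{k+1}\,\delta\mathbf{x}_{k+1}^{\mathsf T})$ be the estimation error covariances at time steps $k$ and $k+1$. Suppose that the quadratic constraint $$\begin{bmatrix}\delta\mathbf{x}_k\\ \mathbf{p}_k\end{bmatrix}^{\mathsf T}\mathbf{M}\begin{bmatrix}\delta\mathbf{x}_k\\ \mathbf{p}_k\end{bmatrix}\ge 0$$ holds, where $\mathbf{M}=\mathbf{U}^{\mathsf T}\mathbf{\Lambda}\mathbf{U}$, $\mathbf{U}=\mathrm{diag}(\mathbf{C}_\theta,\mathbf{1})$, and $\mathbf{\Lambda}$ is the symmetric matrix defining the quadratic constraint. If there exist $\mathbf{Z}\in\mathbb{S}^n$, $\mathbf{Y}\in\mathbb{S}^n$ and $\xi\ge 0$ satisfying $$\mathbf{Z}-\mathbf{Y}<0,\qquad \begin{bmatrix}\mathbf{A}_k^{\mathsf T}(\mathbf{Z}-\mathbf{Y})\mathbf{A}_k & \mathbf{A}_k^{\mathsf T}\mathbf{Z}\mathbf{B}_p\\ \mathbf{B}_p^{\mathsf T}\mathbf{Z}\mathbf{A}_k & \mathbf{B}_p^{\mathsf T}\mathbf{Z}\mathbf{B}_p\end{bmatrix}+\xi\,\mathbf{M}\le 0,$$ then $$\mathrm{tr}(\mathbf{P}_{k+1}^-\mathbf{Z})\le \mathrm{tr}(\mathbf{B}_w\mathbf{Q}\mathbf{B}_w^{\mathsf T}\mathbf{Z})+\mathrm{tr}(\mathbf{A}_k\mathbf{P}_k^+\mathbf{A}_k^{\mathsf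 T}\mathbf{Y}).$$
   Context: $\mathbb{S}^n$ denotes the real symmetric $n\times n$ matrices. For symmetric matrices, $<0$ means negative definite and $\le 0$ means negative semidefinite; for scalars, inequalities are the usual ones. $\mathbf{1}$ is the identity matrix, $\mathbf{0}$ is a zero matrix, $\mathrm{diag}(\cdot,\cdot)$ is a block-diagonal matrix, $\mathrm{tr}$ is the trace, and $\mathbb{E}$ is expectation. The matrices $\mathbf{Z}$ and $\mathbf{Y}$ are not individually required to be definite. Origin of the setting: for discrete-time nonlinear dynamics $\mathbf{x}_{k+1}=\mathbf{f}_d(\mathbf{x}_k,\mathbf{u}_k,\mathbf{w}_k)$ with known input $\mathbf{u}_k$ and state estimate $\check{\mathbf{x}}_k$, the error update $\delta\mathbf{x}_{k+1}=\mathbf{f}_d(\mathbf{x}_k,\mathbf{u}_k,\mathbf{w}_k)-\mathbf{f}_d(\check{\mathbf{x}}_k,\mathbf{u}_k,\mathbf{0})$ is decomposed exactly (without approximation) into the displayed form, with $\mathbf{A}_k$ the Jacobian of the dynamics in $\mathbf{x}$ at $(\check{\mathbf{x}}_k,\mathbf{u}_k)$. The matrices $\mathbf{B}_p,\mathbf{B}_w,\mathbf{C}_\theta$ and the function $\mathbf{\Delta}_k$ may change with $k$. The quadratic constraint bounds the input-output relation of $\mathbf{\Delta}_k$: it is $\begin{bmatrix}\boldsymbol{\theta}_k\\ \mathbf{p}_k\end{bmatrix}^{\mathsf T}\mathbf{\Lambda}\begin{bmatrix}\boldsymbol{\theta}_k\\ \mathbf{p}_k\end{bmatrix}\ge 0$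 rewritten in terms of $\delta\mathbf{x}_k$ and $\mathbf{p}_k$. It is assumed to hold for the realized values of $(\delta\mathbf{x}_k,\mathbf{p}_k)$ (almost surely). *)

theory Defs
  imports "HOL-Probability.Probability"
begin

definition outer_prod :: "real^'n \<Rightarrow> real^'m \<Rightarrow> real^'m^'n" where
  "outer_prod x y = (\<chi> i j. x $ i * y $ j)"

definition stack_vec :: "real^'n \<Rightarrow> real^'m \<Rightarrow> real^('n + 'm)" where
  "stack_vec x y = (\<chi> i. case i of Inl a \<Rightarrow> x $ a | Inr b \<Rightarrow> y $ b)"

definition block_mat ::
  "real^'n^'p \<Rightarrow> real^'m^'p \<Rightarrow> real^'n^'q \<Rightarrow> real^'m^'q \<Rightarrow> real^('n + 'm)^('p + 'q)" where
  "block_mat A B C D = (\<chi> i j.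
     case i of
       Inl a \<Rightarrow> (case j of Inl c \<Rightarrow> A $ a $ c | Inr d \<Rightarrow> B $ a $ d)
     | Inr b \<Rightarrow> (case j of Inl c \<Rightarrow> C $ b $ c | Inr d \<Rightarrow> D $ b $ d))"

definition block_diag :: "real^'n^'p \<Rightarrow> real^'m^'q \<Rightarrow> real^('n + 'm)^('p + 'q)" where
  "block_diag A D = block_mat A 0 0 D"

definition sym_mat :: "real^'n^'n \<Rightarrow> bool" where
  "sym_mat A \<longleftrightarrow> transpose A = A"

definition neg_def :: "real^'n^'n \<Rightarrow> bool" where
  "neg_def A \<longleftrightarrow> sym_mat A \<and> (\<forall>x. x \<noteq> 0 \<longrightarrow> x \<bullet> (A *v x) < 0)"

definition neg_semidef :: "real^'n^'n \<Rightarrow> bool" where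
  "neg_semidef A \<longleftrightarrow> sym_mat A \<and> (\<forall>x. x \<bullet> (A *v x) \<le> 0)"

(* The case s = 0 is a point mass, so that singular covariance matrices are allowed below. *)
definition gaussian_var :: "'a measure \<Rightarrow> ('a \<Rightarrow> real) \<Rightarrow> bool" where
  "gaussian_var \<mu> X \<longleftrightarrow> X \<in> borel_measurable \<mu> \<and>
     (\<exists>m s. (s = 0 \<and> (AE \<omega> in \<mu>. X \<omega> = m)) \<or>
            (s > 0 \<and> distributed \<mu> lborel X (normal_density m s)))"

(* Joint Gaussianity over all times: finite linear combinations of all coordinates are Gaussian. *)
definition gaussian_process :: "'a measure \<Rightarrow> (nat \<Rightarrow> 'a \<Rightarrow> real^'n) \<Rightarrow> bool" where
  "gaussian_process \<mu> w \<longleftrightarrow>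
     (\<forall>J c. finite J \<longrightarrow> gaussian_var \<mu> (\<lambda>\<omega>. \<Sum>j\<in>J. c j \<bullet> w j \<omega>))"

(* Uncorrelated across time; by joint Gaussianity this is the same as independence across time. *)
definition zero_mean_gaussian_white_noise ::
  "'a measure \<Rightarrow> (nat \<Rightarrow> 'a \<Rightarrow> real^'n) \<Rightarrow> bool" where
  "zero_mean_gaussian_white_noise \<mu> w \<longleftrightarrow>
     gaussian_process \<mu> w \<and>
     (\<forall>j. has_bochner_integral \<mu> (w j) 0) \<and>
     (\<forall>i j. i \<noteq> j \<longrightarrow> has_bochner_integral \<mu> (\<lambda>\<omega>. outer_prod (w i \<omega>) (w j \<omega>)) 0)"

end

theory Submission
  imports Defs
begin

text \<open>
  Write \<open>x\<close>, \<open>p\<close>, \<open>w\<close> for the random vectors at time \<open>k\<close>, and \<open>v = A x + B\<^sub>p p\<close>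
  for the noise-free part of the update. Evaluating the matrix inequality at \<open>(x, p)\<close> and dropping
  the multiplier term, which is nonnegative by the quadratic constraint (an S-procedure argument),
  gives the pointwise bound \<open>v\<^sup>T Z v \<le> (A x)\<^sup>T Y (A x)\<close>: the unknown \<open>p\<close> has disappeared from the
  right-hand side (\<open>lmi_imp_quadratic_bound\<close>). Adding the noise,
  \<open>(v + B\<^sub>w w)\<^sup>T Z (v + B\<^sub>w w) \<le> (A x)\<^sup>T Y (A x) + 2 v\<^sup>T Z B\<^sub>w w + (B\<^sub>w w)\<^sup>T Z (B\<^sub>w w)\<close>
  almost surely, and the theorem is the expectation of this inequality. The expectation of a form
  \<open>v\<^sup>T N u\<close> is the trace of the second-moment matrix of \<open>u\<close> and \<open>v\<close> multiplied by \<open>N\<close>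
  (\<open>has_bochner_integral_bilinear_form\<close>), so that the cross term vanishes, because \<open>w\<close> is
  uncorrelated with \<open>x\<close> and \<open>p\<close>, and the other terms become the traces.

  Since no second moment of \<open>p\<close> is assumed, the individual terms of the matrix inequality that are
  quadratic in \<open>p\<close> may fail to have expectations. This is why they are eliminated pointwise, before
  expectations are taken.
\<close>

lemma trace_outer_prod_mult:
  fixes N :: "real^'n^'m"
  shows "trace (outer_prod u v ** N) = v \<bullet> (N *v u)"
proof -
  have "trace (outer_prod u v ** N) = (\<Sum>i\<in>UNIV. \<Sum>j\<in>UNIV. u $ i * v $ j * N $ j $ i)"
    by (simp add: trace_def matrix_matrix_mult_def outer_prod_def)
  also have "\<dots> = (\<Sum>j\<in>UNIV. \<Sum>i\<in>UNIV. u $ i * v $ j * N $ j $ i)"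
    by (rule sum.swap)
  also have "\<dots> = v \<bullet> (N *v u)"
    by (simp add: inner_vec_def matrix_vector_mult_def sum_distrib_left mult_ac)
  finally show ?thesis .
qed

lemma bounded_linear_trace_mult:
  fixes N :: "real^'n^'m"
  shows "bounded_linear (\<lambda>S :: real^'m^'n. trace (S ** N))"
proof (rule linear_conv_bounded_linear[THEN iffD1], rule linearI)
  show "trace ((S + T) ** N) = trace (S ** N) + trace (T ** N)" for S T :: "real^'m^'n"
    by (simp add: trace_def matrix_matrix_mult_def distrib_right sum.distrib)
  show "trace ((c *\<^sub>R S) ** N) = c *\<^sub>R trace (S ** N)" for c and S :: "real^'m^'n"
    by (simp add: trace_def matrix_matrix_mult_def sum_distrib_left mult_ac)
qed

text \<open>
  A bilinear form in \<open>u\<close> and \<open>v\<close> is a linear functional of their outer product, hence its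
  expectation is that functional applied to the second-moment matrix.
\<close>

lemma has_bochner_integral_bilinear_form:
  fixes N :: "real^'n^'m"
  assumes "has_bochner_integral \<mu> (\<lambda>\<omega>. outer_prod (u \<omega>) (v \<omega>)) S"
  shows "has_bochner_integral \<mu> (\<lambda>\<omega>. v \<omega> \<bullet> (N *v u \<omega>)) (trace (S ** N))"
  using has_bochner_integral_bounded_linear[OF bounded_linear_trace_mult[of N] assms]
  by (simp add: trace_outer_prod_mult)

lemma inner_matrix_mult_congruence:
  fixes B :: "real^'n^'k" and N :: "real^'l^'k" and D :: "real^'m^'l"
  shows "u \<bullet> ((transpose B ** N ** D) *v v) = (B *v u) \<bullet> (N *v (D *v v))"
  using dot_lmul_matrix[of "N *v (D *v v)" B u]
  by (simp add: matrix_vector_mul_assoc[symmetric] transpose_matrix_vector inner_commute)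

lemma sym_mat_inner_commute:
  assumes "sym_mat N"
  shows "u \<bullet> (N *v v) = v \<bullet> (N *v u)"
  using assms dot_lmul_matrix[of u N v] transpose_matrix_vector[of N u]
  by (simp add: sym_mat_def inner_commute)

lemma inner_block_mat_stack_vec:
  fixes x :: "real^'n" and p :: "real^'m"
  shows "stack_vec x p \<bullet> (block_mat E F G H *v stack_vec x p) =
    x \<bullet> (E *v x) + x \<bullet> (F *v p) + p \<bullet> (G *v x) + p \<bullet> (H *v p)"
proof -
  have split_sum: "(\<Sum>i\<in>UNIV. f i) = (\<Sum>a\<in>UNIV. f (Inl a)) + (\<Sum>b\<in>UNIV. f (Inr b))"
    for f :: "'n + 'm \<Rightarrow> real"
    using sum.Plus[of "UNIV :: 'n set" "UNIV :: 'm set" f] by (simp add: comp_def)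
  show ?thesis
    by (simp add: inner_vec_def matrix_vector_mult_def split_sum block_mat_def stack_vec_def
        distrib_left sum.distrib)
qed

text \<open>
  The \<open>Z\<close>-terms of the block form complete the square \<open>(A x + B p)\<^sup>T Z (A x + B p)\<close>; only the upper
  left block carries \<open>Y\<close>, so the remainder is \<open>-(A x)\<^sup>T Y (A x)\<close>, free of \<open>p\<close>.
\<close>

lemma lmi_imp_quadratic_bound:
  fixes A :: "real^'n^'n" and B :: "real^'m^'n" and x :: "real^'n" and p :: "real^'m"
  assumes Z: "sym_mat Z" and "\<xi> \<ge> 0"
    and lmi: "neg_semidef
           (block_mat
              (transpose A ** (Z - Y) ** A) (transpose A ** Z ** B)
              (transpose B ** Z ** A)       (transpose B ** Z ** B)
            + \<xi> *\<^sub>R M)"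
    and qc: "stack_vec x p \<bullet> (M *v stack_vec x p) \<ge> 0"
  shows "(A *v x + B *v p) \<bullet> (Z *v (A *v x + B *v p)) \<le> (A *v x) \<bullet> (Y *v (A *v x))"
proof -
  let ?z = "stack_vec x p"
  let ?L = "block_mat
              (transpose A ** (Z - Y) ** A) (transpose A ** Z ** B)
              (transpose B ** Z ** A)       (transpose B ** Z ** B)"
  have "?z \<bullet> ((?L + \<xi> *\<^sub>R M) *v ?z) \<le> 0"
    using lmi by (simp add: neg_semidef_def)
  then have "?z \<bullet> (?L *v ?z) + \<xi> * (?z \<bullet> (M *v ?z)) \<le> 0"
    by (simp add: matrix_vector_mult_add_rdistrib inner_add_right scaleR_matrix_vector_assoc[symmetric])
  moreover have "\<xi> * (?z \<bullet> (M *v ?z)) \<ge> 0"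
    using \<open>\<xi> \<ge> 0\<close> qc by simp
  ultimately have "?z \<bullet> (?L *v ?z) \<le> 0"
    by linarith
  then show ?thesis
    by (simp add: inner_block_mat_stack_vec inner_matrix_mult_congruence
        matrix_vector_mult_diff_rdistrib matrix_vector_right_distrib inner_add_left inner_add_right
        inner_diff_right)
qed

theorem mainTheorem1:
  fixes \<mu> :: "'a measure"
    and k :: nat
    and \<delta>x :: "nat \<Rightarrow> 'a \<Rightarrow> real^'n"
    and p :: "nat \<Rightarrow> 'a \<Rightarrow> real^'np"
    and w :: "nat \<Rightarrow> 'a \<Rightarrow> real^'nw"
    and \<theta> :: "nat \<Rightarrow> 'a \<Rightarrow> real^'nt"
    and \<Delta> :: "nat \<Rightarrow> real^'nt \<Rightarrow> real^'np"
    and A :: "nat \<Rightarrow> real^'n^'n"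
    and Bp :: "real^'np^'n"
    and Bw :: "real^'nw^'n"
    and C\<theta> :: "real^'n^'nt"
    and Q :: "real^'nw^'nw"
    and P_plus P_minus :: "nat \<Rightarrow> real^'n^'n"
    and \<Lambda> :: "real^('nt + 'np)^('nt + 'np)"
    and U :: "real^('n + 'np)^('nt + 'np)"
    and M :: "real^('n + 'np)^('n + 'np)"
    and Z Y :: "real^'n^'n"
    and \<xi> :: real
  assumes "prob_space \<mu>"
    and "\<delta>x k \<in> borel_measurable \<mu>"
    and "\<delta>x (Suc k) \<in> borel_measurable \<mu>"
    and "p k \<in> borel_measurable \<mu>"
    and update: "AE \<omega> in \<mu>. \<delta>x (Suc k) \<omega> = A k *v \<delta>x k \<omega> + Bp *v p k \<omega> + Bw *v w k \<omega>"
    and p: "AE \<omega> in \<mu>. p k \<omega> = \<Delta> k (\<theta> k \<omega>)"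
    and \<theta>: "AE \<omega> in \<mu>. \<theta> k \<omega> = C\<theta> *v \<delta>x k \<omega>"
    and noise: "zero_mean_gaussian_white_noise \<mu> w"
    and Q: "has_bochner_integral \<mu> (\<lambda>\<omega>. outer_prod (w k \<omega>) (w k \<omega>)) Q"
    and w_\<delta>x: "has_bochner_integral \<mu> (\<lambda>\<omega>. outer_prod (w k \<omega>) (\<delta>x k \<omega>)) 0"
    and w_p: "has_bochner_integral \<mu> (\<lambda>\<omega>. outer_prod (w k \<omega>) (p k \<omega>)) 0"
    and P_plus:
      "has_bochner_integral \<mu> (\<lambda>\<omega>. outer_prod (\<delta>x k \<omega>) (\<delta>x k \<omega>)) (P_plus k)"
    and P_minus:
      "has_bochner_integral \<mu> (\<lambda>\<omega>. outer_prod (\<delta>x (Suc k) \<omega>) (\<delta>x (Suc k) \<omega>)) (P_minus (Suc k))"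
    and \<Lambda>: "sym_mat \<Lambda>"
    and U: "U = block_diag C\<theta> (mat 1)"
    and M: "M = transpose U ** \<Lambda> ** U"
    and quadratic_constraint:
      "AE \<omega> in \<mu>. stack_vec (\<delta>x k \<omega>) (p k \<omega>) \<bullet> (M *v stack_vec (\<delta>x k \<omega>) (p k \<omega>)) \<ge> 0"
    and "sym_mat Z" and "sym_mat Y" and "\<xi> \<ge> 0"
    and "neg_def (Z - Y)"
    and "neg_semidef
           (block_mat
              (transpose (A k) ** (Z - Y) ** A k) (transpose (A k) ** Z ** Bp)
              (transpose Bp ** Z ** A k)          (transpose Bp ** Z ** Bp)
            + \<xi> *\<^sub>R M)"
  shows "trace (P_minus (Suc k) ** Z)
           \<le> trace (Bw ** Q ** transpose Bw ** Z) + trace (A k ** P_plus k ** transpose (A k) ** Y)"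
proof -
  let ?x = "\<delta>x k" and ?p = "p k" and ?w = "w k" and ?A = "A k"
  let ?rhs = "\<lambda>\<omega>. ?x \<omega> \<bullet> ((transpose ?A ** Y ** ?A) *v ?x \<omega>)
    + 2 * (?x \<omega> \<bullet> ((transpose ?A ** Z ** Bw) *v ?w \<omega>))
    + 2 * (?p \<omega> \<bullet> ((transpose Bp ** Z ** Bw) *v ?w \<omega>))
    + ?w \<omega> \<bullet> ((transpose Bw ** Z ** Bw) *v ?w \<omega>)"
  have bound: "AE \<omega> in \<mu>. \<delta>x (Suc k) \<omega> \<bullet> (Z *v \<delta>x (Suc k) \<omega>) \<le> ?rhs \<omega>"
    using update quadratic_constraint
  proof eventually_elim
    case (elim \<omega>)
    define v where "v = ?A *v ?x \<omega> + Bp *v ?p \<omega>"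
    define b where "b = Bw *v ?w \<omega>"
    have "(v + b) \<bullet> (Z *v (v + b)) = v \<bullet> (Z *v v) + 2 * (v \<bullet> (Z *v b)) + b \<bullet> (Z *v b)"
      using sym_mat_inner_commute[OF \<open>sym_mat Z\<close>, of b v]
      by (simp add: matrix_vector_right_distrib inner_add_left inner_add_right)
    moreover have "v \<bullet> (Z *v v) \<le> (?A *v ?x \<omega>) \<bullet> (Y *v (?A *v ?x \<omega>))"
      unfolding v_def using lmi_imp_quadratic_bound assms(18,20,22) elim(2) by blast
    ultimately show ?case
      unfolding elim(1) inner_matrix_mult_congruence v_def b_def by (simp add: inner_add_left)
  qed
  have lhs_integral: "has_bochner_integral \<mu>
      (\<lambda>\<omega>. \<delta>x (Suc k) \<omega> \<bullet> (Z *v \<delta>x (Suc k) \<omega>)) (trace (P_minus (Suc k) ** Z))"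
    by (rule has_bochner_integral_bilinear_form[OF P_minus])
  have rhs_integral: "has_bochner_integral \<mu> ?rhs
      (trace (P_plus k ** (transpose ?A ** Y ** ?A))
        + 2 * trace (0 ** (transpose ?A ** Z ** Bw)) + 2 * trace (0 ** (transpose Bp ** Z ** Bw))
        + trace (Q ** (transpose Bw ** Z ** Bw)))"
    by (intro has_bochner_integral_add has_bochner_integral_mult_right
        has_bochner_integral_bilinear_form P_plus Q w_\<delta>x w_p)
  have "trace (P_minus (Suc k) ** Z) \<le>
      trace (P_plus k ** (transpose ?A ** Y ** ?A)) + trace (Q ** (transpose Bw ** Z ** Bw))"
    using integral_mono_AE[OF _ _ bound] lhs_integral rhs_integral
    by (auto simp: has_bochner_integral_iff trace_def)
  moreover have "trace (P_plus k ** (transpose ?A ** Y ** ?A))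
      = trace (?A ** P_plus k ** transpose ?A ** Y)"
    using trace_mul_sym[of "P_plus k ** transpose ?A ** Y" ?A] by (simp add: matrix_mul_assoc)
  moreover have "trace (Q ** (transpose Bw ** Z ** Bw)) = trace (Bw ** Q ** transpose Bw ** Z)"
    using trace_mul_sym[of "Q ** transpose Bw ** Z" Bw] by (simp add: matrix_mul_assoc)
  ultimately show ?thesis
    by linarith
qed

end
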